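(* Let $q\in\mathcal S$ be a switching signal with switching times $t_1<t_2<\dots$ in $(t_0,\infty)$, and write $q_k:=q(t_k)$. Consider the switched system with input- and state-dependent jumps $$(\mathrm{I})\quad\begin{cases}\dot{\tilde z}_{q_k}(t)=J_{q_k}\tilde z_{q_k}(t)+\tilde B_{q_k}u(t), & t\in(t_k,t_{k+1}),\ k\ge 0,\\ \tilde z_{q_k}(t_k^+)=\tilde P_{q_k,q_{k-1}}\tilde z_{q_{k-1}}(t_k^-)+\tilde{\mathcal B}_{q_k,q_{k-1}}U_{q_{k-1}}(t_k^-),& k\ge 1,\\ \tilde z_{q_0}(t_0)=0,\end{cases}$$ and the switched system with only state-dependent jumps and augmented input $$(\mathrm{II})\quad\begin{cases}\dot{\tilde z}_{q_k}(t)=J_{q_k}\tilde z_{q_k}(t)+\bar B_{q_k,q_{k-1}}\bar u_{q_k}(t), & t\in(t_k,t_{k+1}),\ k\ge 0,\\ \tilde z_{q_k}(t_k^+)=\tilde P_{q_k,q_{k-1}}\tilde z_{q_{k-1}}(t_k^-),& k\ge 1,\\ \tilde z_{q_0}(t_0)=0,\end{cases}$$ where $\bar B_{q_k,q_{k-1}}:=\begin{bmatrix}\tilde B_{q_k} & \tilde{\mathcal B}_{q_k,q_{k-1}}\end{bmatrix}$ and $\bar u_{q_k}(t)\in\mathbb R^{m+m\nu_{q_{k-1}}}$ is a free input for $k\ge1$ (for $k=0$, where there is no preceding mode, $\bar B:=\tilde B_{q_0}$ and $\bar u_{q_0}(t)\in\mathbb R^m$). Then the reachable set via $q$ of (I)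 is contained in the reachable set via $q$ of (II).
   Context: Setting. $\mathcal J=\{1,\dots,M\}$, and $\mathcal S$ is the set of right-continuous $q:\mathbb R\to\mathcal J$ with a locally finite number of jumps. For each $j\in\mathcal J$ let $E_j,A_j\in\mathbb R^{n\times n}$, $B_j\in\mathbb R^{n\times m}$, where the pair $(E_j,A_j)$ is regular ($\det(sE_j-A_j)\not\equiv0$) and all its finite eigenvalues have negative real part. Fix invertible $S_j,T_j\in\mathbb R^{n\times n}$ bringing the pair to quasi-Weierstrass form: $$S_jE_jT_j=\begin{bmatrix}I&0\\0&N_j\end{bmatrix},\qquad S_jA_jT_j=\begin{bmatrix}J_j&0\\0&I\end{bmatrix},$$ with $N_j$ nilpotent of nilpotency index $\nu_j$ and $J_j\in\mathbb R^{n_{J_j}\times n_{J_j}}$ (which is then asymptotically stable). For $i,j\in\mathcal J$ define $\tilde B_j:=[\,I_{n_{J_j}}\ 0\,]S_jB_j$, $\tilde P_{j,i}:=[\,I_{n_{J_j}}\ 0\,]\,T_j^{-1}T_i\,[\,I_{n_{J_i}}\ 0\,]^{\mathsf T}\in\mathbb R^{n_{J_j}\times n_{J_i}}$, and $$\tilde{\mathcal B}_{j,i}:=[\,I_{n_{J_j}}\ 0\,]\,T_j^{-1}T_i\left[\begin{bmatrix}0&0\\0&N_i^{0}\end{bmatrix}S_iB_i,\ \dots,\ \begin{bmatrix}0&0\\0&N_i^{\nu_i-1}\end{bmatrix}S_iB_i\right]\in\mathbb R^{n_{J_j}\times m\nu_i}.$$ For an input $u$ with values in $\mathbb R^m$,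 $U_i(t):=[u(t)^{\mathsf T},\dot u(t)^{\mathsf T},\dots,u^{(\nu_i-1)}(t)^{\mathsf T}]^{\mathsf T}$. Inputs are piecewise smooth functions, so that one-sided limits of all derivatives exist; $t^{\pm}$ denotes one-sided evaluation. A state $x$ is reachable via $q$ for a system if there exist $t_{\mathrm f}>t_0$ and an input on $[t_0,t_{\mathrm f}]$ such that the solution started from the zero state at $t_0$ has value $x$ at time $t_{\mathrm f}$ (the state then lies in $\mathbb R^{n_{J_j}}$ with $j$ the mode active at that time). The reachable set via $q$ is the set of all states reachable via $q$.
   Formalization: If the final time t_f is a switching time t_k, the value reached is taken to be the left limit z(t_k^-), in the mode active just before t_k; with the post-jump value z(t_k^+) the inclusion can fail, since (II) has had no time to use the new input. *)

theory Defs
  imports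
    "HOL-Analysis.Analysis"
    "HOL-Library.Extended_Nat"
    "Jordan_Normal_Form.Determinant"
    "Jordan_Normal_Form.Gauss_Jordan_Elimination"
begin

unbundle no vec_syntax

section \<open>Regular pairs and quasi-Weierstrass form\<close>

definition pencil :: "real mat \<Rightarrow> real mat \<Rightarrow> complex \<Rightarrow> complex mat" where
  "pencil E A s = s \<cdot>\<^sub>m map_mat complex_of_real E - map_mat complex_of_real A"

definition regular_pair :: "real mat \<Rightarrow> real mat \<Rightarrow> bool" where
  "regular_pair E A \<longleftrightarrow> (\<exists>s. det (pencil E A s) \<noteq> 0)"

definition finite_eigenvalue :: "real mat \<Rightarrow> real mat \<Rightarrow> complex \<Rightarrow> bool" where
  "finite_eigenvalue E A s \<longleftrightarrow> det (pencil E A s) = 0"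

definition nilpotent_mat :: "real mat \<Rightarrow> bool" where
  "nilpotent_mat N \<longleftrightarrow> (\<exists>k. N ^\<^sub>m k = 0\<^sub>m (dim_row N) (dim_row N))"

text \<open>The index of the empty matrix is 0.\<close>

definition nilpotency_index :: "real mat \<Rightarrow> nat" where
  "nilpotency_index N = (LEAST k. N ^\<^sub>m k = 0\<^sub>m (dim_row N) (dim_row N))"

definition quasi_weierstrass ::
  "nat \<Rightarrow> real mat \<Rightarrow> real mat \<Rightarrow> real mat \<Rightarrow> real mat \<Rightarrow> nat \<Rightarrow> real mat \<Rightarrow> real mat \<Rightarrow> bool" where
  "quasi_weierstrass n E A S T d J N \<longleftrightarrow>
     S \<in> carrier_mat n n \<and> invertible_mat S \<and> T \<in> carrier_mat n n \<and> invertible_mat T \<and>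
     d \<le> n \<and> J \<in> carrier_mat d d \<and> N \<in> carrier_mat (n - d) (n - d) \<and> nilpotent_mat N \<and>
     S * E * T = four_block_mat (1\<^sub>m d) (0\<^sub>m d (n - d)) (0\<^sub>m (n - d) d) N \<and>
     S * A * T = four_block_mat J (0\<^sub>m d (n - d)) (0\<^sub>m (n - d) d) (1\<^sub>m (n - d))"

section \<open>The switched system data\<close>

text \<open>Families are indexed by the modes \<open>1, \<dots>, n_modes\<close>; values at other indices are irrelevant.\<close>

record swdae =
  n_modes :: nat
  dim_x :: nat
  dim_u :: nat
  Emat :: "nat \<Rightarrow> real mat"
  Amat :: "nat \<Rightarrow> real mat"
  Bmat :: "nat \<Rightarrow> real mat"
  Smat :: "nat \<Rightarrow> real mat"
  Tmat :: "nat \<Rightarrow> real mat"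
  dimJ :: "nat \<Rightarrow> nat"
  Jmat :: "nat \<Rightarrow> real mat"
  Nmat :: "nat \<Rightarrow> real mat"

definition nu :: "swdae \<Rightarrow> nat \<Rightarrow> nat" where
  "nu D j = nilpotency_index (Nmat D j)"

text \<open>The \<open>d \<times> n\<close> matrix \<open>[I 0]\<close> (used for \<open>d \<le> n\<close>).\<close>

definition Iproj :: "nat \<Rightarrow> nat \<Rightarrow> real mat" where
  "Iproj d n = mat d n (\<lambda>(r, c). if r = c then 1 else 0)"

definition hcat :: "real mat \<Rightarrow> real mat \<Rightarrow> real mat" where
  "hcat A B = four_block_mat A B (0\<^sub>m 0 (dim_col A)) (0\<^sub>m 0 (dim_col B))"

text \<open>\<open>[C\<^sub>0, \<dots>, C\<^sub>l\<^sub>-\<^sub>1]\<close> for \<open>n \<times> m\<close> blocks \<open>C\<^sub>k\<close>.\<close>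

definition hcat_blocks :: "nat \<Rightarrow> nat \<Rightarrow> nat \<Rightarrow> (nat \<Rightarrow> real mat) \<Rightarrow> real mat" where
  "hcat_blocks n m l C = mat n (m * l) (\<lambda>(r, c). C (c div m) $$ (r, c mod m))"

definition Btilde :: "swdae \<Rightarrow> nat \<Rightarrow> real mat" where
  "Btilde D j = Iproj (dimJ D j) (dim_x D) * Smat D j * Bmat D j"

definition TinvT :: "swdae \<Rightarrow> nat \<Rightarrow> nat \<Rightarrow> real mat" where
  "TinvT D j i = Iproj (dimJ D j) (dim_x D) * the (mat_inverse (Tmat D j)) * Tmat D i"

definition Ptilde :: "swdae \<Rightarrow> nat \<Rightarrow> nat \<Rightarrow> real mat" where
  "Ptilde D j i = TinvT D j i * transpose_mat (Iproj (dimJ D i) (dim_x D))"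

definition Bcal :: "swdae \<Rightarrow> nat \<Rightarrow> nat \<Rightarrow> real mat" where
  "Bcal D j i = TinvT D j i * hcat_blocks (dim_x D) (dim_u D) (nu D i) (\<lambda>k.
     let d = dimJ D i; e = dim_x D - d in
       four_block_mat (0\<^sub>m d d) (0\<^sub>m d e) (0\<^sub>m e d) (Nmat D i ^\<^sub>m k) * Smat D i * Bmat D i)"

section \<open>Switching signals\<close>

definition switching_signal :: "nat \<Rightarrow> (real \<Rightarrow> nat) \<Rightarrow> bool" where
  "switching_signal M q \<longleftrightarrow>
     (\<forall>t. q t \<in> {1..M}) \<and> (\<forall>t. continuous (at_right t) q) \<and>
     (\<forall>a b. finite {t \<in> {a..b}. \<not> isCont q t})"

text \<open>There are \<open>K \<le> \<infinity>\<close> switching times after \<open>t0\<close>; they are \<open>tau 1 < tau 2 < \<dots>\<close>, and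
  \<open>tau 0 = t0\<close>. Values \<open>tau k\<close> with \<open>k > K\<close> are irrelevant.\<close>

definition switching_times :: "(real \<Rightarrow> nat) \<Rightarrow> real \<Rightarrow> enat \<Rightarrow> (nat \<Rightarrow> real) \<Rightarrow> bool" where
  "switching_times q t0 K tau \<longleftrightarrow>
     tau 0 = t0 \<and> strict_mono_on {k. enat k \<le> K} tau \<and>
     tau ` {k. 1 \<le> k \<and> enat k \<le> K} = {t. t0 < t \<and> \<not> isCont q t}"

text \<open>On the horizon \<open>[tau 0, tf]\<close> only the segments with \<open>tau k < tf\<close> are present, the last of
  them being cut off at \<open>tf\<close>.\<close>

definition present :: "enat \<Rightarrow> (nat \<Rightarrow> real) \<Rightarrow> real \<Rightarrow> nat \<Rightarrow> bool" where
  "present K tau tf k \<longleftrightarrow> enat k \<le> K \<and> tau k < tf"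

definition seg_end :: "enat \<Rightarrow> (nat \<Rightarrow> real) \<Rightarrow> real \<Rightarrow> nat \<Rightarrow> real" where
  "seg_end K tau tf k = (if present K tau tf (Suc k) then tau (Suc k) else tf)"

section \<open>Inputs and solutions\<close>

text \<open>Piecewise smooth on \<open>[a, b]\<close>: smooth off finitely many points, and all derivatives have
  one-sided limits everywhere (at \<open>a\<close> from the right, at \<open>b\<close> from the left).\<close>

definition pw_smooth :: "real \<Rightarrow> real \<Rightarrow> (real \<Rightarrow> real) \<Rightarrow> bool" where
  "pw_smooth a b f \<longleftrightarrow>
     (\<exists>F. finite F \<and> (\<forall>n. \<forall>t\<in>{a<..<b} - F. (deriv ^^ n) f differentiable (at t))) \<and>
     (\<forall>n. \<forall>t\<in>{a<..b}. \<exists>l. ((deriv ^^ n) f \<longlongrightarrow> l) (at_left t)) \<and>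
     (\<forall>n. \<forall>t\<in>{a..<b}. \<exists>l. ((deriv ^^ n) f \<longlongrightarrow> l) (at_right t))"

definition input_on :: "nat \<Rightarrow> real \<Rightarrow> real \<Rightarrow> (real \<Rightarrow> real vec) \<Rightarrow> bool" where
  "input_on m a b u \<longleftrightarrow>
     (\<forall>t\<in>{a..b}. u t \<in> carrier_vec m) \<and> (\<forall>i<m. pw_smooth a b (\<lambda>t. u t $ i))"

text \<open>\<open>U(t\<^sup>-)\<close>, i.e. the stacked left limits of \<open>u, u', \<dots>, u\<^bsup>(l-1)\<^esup>\<close> at \<open>t\<close>.\<close>

definition U_left :: "nat \<Rightarrow> nat \<Rightarrow> (real \<Rightarrow> real vec) \<Rightarrow> real \<Rightarrow> real vec" where
  "U_left m l u t =
     vec (m * l) (\<lambda>c. Lim (at_left t) ((deriv ^^ (c div m)) (\<lambda>s. u s $ (c mod m))))"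

text \<open>The ODE \<open>z' = J z + B u\<close> on \<open>(a, b)\<close>. As \<open>u\<close> may jump, \<open>z\<close> is only required to be
  differentiable off a finite set. Continuity on the closed interval means that \<open>z a\<close> and \<open>z b\<close>
  are the one-sided limits \<open>z(a\<^sup>+)\<close> and \<open>z(b\<^sup>-)\<close>.\<close>

definition ode_on ::
  "real mat \<Rightarrow> real mat \<Rightarrow> real \<Rightarrow> real \<Rightarrow> (real \<Rightarrow> real vec) \<Rightarrow> (real \<Rightarrow> real vec) \<Rightarrow> bool" where
  "ode_on J B a b u z \<longleftrightarrow>
     (\<forall>t\<in>{a..b}. z t \<in> carrier_vec (dim_row J)) \<and>
     (\<forall>i<dim_row J. continuous_on {a..b} (\<lambda>t. z t $ i)) \<and>
     (\<exists>F. finite F \<and> (\<forall>t\<in>{a<..<b} - F. \<forall>i<dim_row J.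
        ((\<lambda>s. z s $ i) has_real_derivative (J *\<^sub>v z t + B *\<^sub>v u t) $ i) (at t)))"

text \<open>A solution is the family \<open>z k\<close> of its segments, on \<open>[tau k, tau (k + 1)]\<close> resp. up to \<open>tf\<close>.\<close>

definition solution_I ::
  "swdae \<Rightarrow> (real \<Rightarrow> nat) \<Rightarrow> enat \<Rightarrow> (nat \<Rightarrow> real) \<Rightarrow> real \<Rightarrow>
     (real \<Rightarrow> real vec) \<Rightarrow> (nat \<Rightarrow> real \<Rightarrow> real vec) \<Rightarrow> bool" where
  "solution_I D q K tau tf u z \<longleftrightarrow>
     (\<forall>k. present K tau tf k \<longrightarrow>
        ode_on (Jmat D (q (tau k))) (Btilde D (q (tau k))) (tau k) (seg_end K tau tf k) u (z k)) \<and>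
     (\<forall>k\<ge>1. present K tau tf k \<longrightarrow>
        z k (tau k) =
          Ptilde D (q (tau k)) (q (tau (k - 1))) *\<^sub>v z (k - 1) (tau k) +
          Bcal D (q (tau k)) (q (tau (k - 1))) *\<^sub>v
            U_left (dim_u D) (nu D (q (tau (k - 1)))) u (tau k)) \<and>
     z 0 (tau 0) = 0\<^sub>v (dimJ D (q (tau 0)))"

definition Bbar :: "swdae \<Rightarrow> (real \<Rightarrow> nat) \<Rightarrow> (nat \<Rightarrow> real) \<Rightarrow> nat \<Rightarrow> real mat" where
  "Bbar D q tau k =
     (if k = 0 then Btilde D (q (tau 0))
      else hcat (Btilde D (q (tau k))) (Bcal D (q (tau k)) (q (tau (k - 1)))))"

definition dim_ubar :: "swdae \<Rightarrow> (real \<Rightarrow> nat) \<Rightarrow> (nat \<Rightarrow> real) \<Rightarrow> nat \<Rightarrow> nat" where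
  "dim_ubar D q tau k =
     (if k = 0 then dim_u D else dim_u D + dim_u D * nu D (q (tau (k - 1))))"

definition input_II ::
  "swdae \<Rightarrow> (real \<Rightarrow> nat) \<Rightarrow> enat \<Rightarrow> (nat \<Rightarrow> real) \<Rightarrow> real \<Rightarrow> (nat \<Rightarrow> real \<Rightarrow> real vec) \<Rightarrow> bool" where
  "input_II D q K tau tf ubar \<longleftrightarrow>
     (\<forall>k. present K tau tf k \<longrightarrow>
        input_on (dim_ubar D q tau k) (tau k) (seg_end K tau tf k) (ubar k))"

definition solution_II ::
  "swdae \<Rightarrow> (real \<Rightarrow> nat) \<Rightarrow> enat \<Rightarrow> (nat \<Rightarrow> real) \<Rightarrow> real \<Rightarrow>
     (nat \<Rightarrow> real \<Rightarrow> real vec) \<Rightarrow> (nat \<Rightarrow> real \<Rightarrow> real vec) \<Rightarrow> bool" where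
  "solution_II D q K tau tf ubar z \<longleftrightarrow>
     (\<forall>k. present K tau tf k \<longrightarrow>
        ode_on (Jmat D (q (tau k))) (Bbar D q tau k) (tau k) (seg_end K tau tf k) (ubar k) (z k)) \<and>
     (\<forall>k\<ge>1. present K tau tf k \<longrightarrow>
        z k (tau k) = Ptilde D (q (tau k)) (q (tau (k - 1))) *\<^sub>v z (k - 1) (tau k)) \<and>
     z 0 (tau 0) = 0\<^sub>v (dimJ D (q (tau 0)))"

section \<open>Reachable sets\<close>

text \<open>The value at the end \<open>tf\<close> of the horizon is \<open>z k tf\<close> for the last present segment \<open>k\<close>.
  If \<open>tf\<close> is not a switching time, then \<open>k\<close> is the segment with \<open>tau k < tf < tau (k + 1)\<close>, and its
  mode is \<open>q tf\<close>. If \<open>tf\<close> is a switching time, the value is the left limit \<open>z(tf\<^sup>-)\<close>, a state of the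
  mode active on the interval ending at \<open>tf\<close>: the jump at \<open>tf\<close> is not part of the horizon.
  (With \<open>z(tf\<^sup>+)\<close> instead, system (I) could reach the input jump at \<open>tf\<close>, for which system (II)
  would have no time left to act, and the inclusion would fail.)\<close>

definition last_seg :: "enat \<Rightarrow> (nat \<Rightarrow> real) \<Rightarrow> real \<Rightarrow> nat \<Rightarrow> bool" where
  "last_seg K tau tf k \<longleftrightarrow> present K tau tf k \<and> \<not> present K tau tf (Suc k)"

definition reachable_I ::
  "swdae \<Rightarrow> (real \<Rightarrow> nat) \<Rightarrow> enat \<Rightarrow> (nat \<Rightarrow> real) \<Rightarrow> real vec set" where
  "reachable_I D q K tau = {x. \<exists>tf>tau 0. \<exists>u z k.
     input_on (dim_u D) (tau 0) tf u \<and> solution_I D q K tau tf u z \<and>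
     last_seg K tau tf k \<and> x = z k tf}"

definition reachable_II ::
  "swdae \<Rightarrow> (real \<Rightarrow> nat) \<Rightarrow> enat \<Rightarrow> (nat \<Rightarrow> real) \<Rightarrow> real vec set" where
  "reachable_II D q K tau = {x. \<exists>tf>tau 0. \<exists>ubar z k.
     input_II D q K tau tf ubar \<and> solution_II D q K tau tf ubar z \<and>
     last_seg K tau tf k \<and> x = z k tf}"

end

theory Submission
  imports Defs
begin

text \<open>On one segment \<open>[a, b]\<close> other than the first, systems (I) and (II) have the same dynamics and differ in
  two ways: (I) adds \<open>x = C c\<close> to the state at time \<open>a\<close>, where \<open>C\<close> is the input jump matrix and \<open>c\<close>
  stacks the left limits of \<open>u\<close> and its derivatives, whereas (II) has an extra input \<open>v\<close>
  entering through \<open>C\<close>. The trajectory \<open>z\<close> of (I) is replaced by \<open>z + w\<close>, where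
  \<open>w' = J w + C v\<close>, \<open>w(a) = - x\<close> and \<open>w(b) = 0\<close>. Then \<open>z + w\<close> starts without the input jump and ends
  where \<open>z\<close> ends, so such corrections, made independently on all later segments, fit together to a
  trajectory of (II) with the same final value.

  That \<open>w\<close> exists is null controllability of the image of \<open>C\<close> in arbitrarily short time. Lemma
  \<open>steering_to_zero\<close> gives it by an explicit polynomial instead of the matrix exponential and
  the Gramian, with \<open>v = \<psi> c\<close> for a scalar \<open>\<psi>\<close>. Let \<open>p\<close> be a polynomial of degree \<open>d\<close> with
  \<open>p(J) x = 0\<close>, and let \<open>\<partial>\<close> denote differentiation. As \<open>p(\<partial>) - p(J)\<close> is a multiple of
  \<open>\<partial> - J\<close>, namely
  \<open>p(\<partial>) - p(J) = (\<partial> - J) (\<Sum>l\<le>d. p\<^sub>l (\<Sum>i<l. \<partial>\<^bsup>l-1-i\<^esup> J\<^bsup>i\<^esup>))\<close>, every smooth scalar function \<open>g\<close>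
  yields a solution of \<open>w' = J w + \<psi> x\<close> with
  \<open>w = (\<Sum>l\<le>d. p\<^sub>l (\<Sum>i<l. g\<^bsup>(l-1-i)\<^esup> J\<^bsup>i\<^esup> x))\<close> and \<open>\<psi> = p(\<partial>) g\<close>. Only the derivatives of \<open>g\<close> of
  order less than \<open>d\<close> enter \<open>w\<close>, and of these the one of order \<open>d - 1\<close> occurs only in the term
  \<open>p\<^sub>d g\<^bsup>(d-1)\<^esup> x\<close>. So \<open>w(b) = 0\<close> if they all vanish at \<open>b\<close>, and \<open>w(a) = - x\<close> if at \<open>a\<close>
  the one of order \<open>d - 1\<close> is \<open>- 1 / p\<^sub>d\<close> and the others vanish (\<open>boundary_poly_exists\<close>).\<close>

section \<open>Polynomials with prescribed boundary derivatives\<close>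

lemma order_higher_pderiv:
  fixes p :: "'a::{idom, semiring_char_0} poly"
  assumes "p \<noteq> 0" "k \<le> order a p"
  shows "(pderiv ^^ k) p \<noteq> 0 \<and> order a ((pderiv ^^ k) p) = order a p - k"
  using assms(2)
proof (induction k)
  case 0
  then show ?case using assms(1) by simp
next
  case (Suc k)
  let ?f = "(pderiv ^^ k) p"
  from Suc have f: "?f \<noteq> 0" "order a ?f = order a p - k" and pos: "order a ?f \<noteq> 0"
    by auto
  then have "order a ?f = Suc (order a (pderiv ?f))"
    using order_pderiv order_root by blast
  moreover have "pderiv ?f \<noteq> 0"
  proof
    assume "pderiv ?f = 0"
    then obtain c where c: "?f = [:c:]"
      using pderiv_iszero by blast
    then have "poly ?f a \<noteq> 0"
      using f(1) by simp
    then show False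
      using pos order_root by blast
  qed
  ultimately show ?case
    using f by simp
qed

lemma poly_higher_pderiv_eq_0:
  fixes p :: "'a::{idom, semiring_char_0} poly"
  assumes "p \<noteq> 0" "k < order a p"
  shows "poly ((pderiv ^^ k) p) a = 0"
  using order_higher_pderiv[of p k a] assms by (simp add: order_root)

lemma poly_higher_pderiv_order_neq_0:
  fixes p :: "'a::{idom, semiring_char_0} poly"
  assumes "p \<noteq> 0"
  shows "poly ((pderiv ^^ order a p) p) a \<noteq> 0"
  using order_higher_pderiv[of p "order a p" a] assms by (simp add: order_root)

lemma higher_deriv_poly: "(deriv ^^ n) (poly (p :: real poly)) = poly ((pderiv ^^ n) p)"
proof (induction n)
  case (Suc n)
  have "deriv (poly q) = poly (pderiv q)" for q :: "real poly"
    using poly_DERIV by (intro ext DERIV_imp_deriv)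
  with Suc show ?case by simp
qed simp

text \<open>The polynomial \<open>(t - a)\<^bsup>d-1\<^esup> (t - b)\<^bsup>d\<^esup>\<close> has zeros of order exactly \<open>d - 1\<close> at \<open>a\<close> and
  \<open>d\<close> at \<open>b\<close>; it only remains to scale its first nonvanishing derivative at \<open>a\<close> to \<open>c\<close>.\<close>

lemma boundary_poly_exists:
  fixes a b c :: real
  assumes "a \<noteq> b"
  shows "\<exists>g. (\<forall>k<d. poly ((pderiv ^^ k) g) a = (if Suc k = d then c else 0)) \<and>
    (\<forall>k<d. poly ((pderiv ^^ k) g) b = 0)"
proof -
  define h where "h = [:-a, 1:] ^ (d - 1) * [:-b, 1:] ^ d"
  have h0: "h \<noteq> 0"
    by (simp add: h_def)
  have other: "order x ([:-y, 1:] ^ n) = 0" if "x \<noteq> y" for x y :: real and n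
    using that by (intro order_0I) simp
  have ord: "order a h = d - 1" "order b h = d"
    using assms h0 unfolding h_def by (simp_all add: order_mult order_power_n_n other)
  define e where "e = poly ((pderiv ^^ (d - 1)) h) a"
  have e: "e \<noteq> 0"
    using poly_higher_pderiv_order_neq_0[OF h0, of a] by (simp add: e_def ord)
  show ?thesis
  proof (intro exI[of _ "Polynomial.smult (c / e) h"] conjI allI impI)
    fix k assume k: "k < d"
    show "poly ((pderiv ^^ k) (Polynomial.smult (c / e) h)) b = 0"
      using poly_higher_pderiv_eq_0[OF h0, of k b] k ord by (simp add: higher_pderiv_smult)
    show "poly ((pderiv ^^ k) (Polynomial.smult (c / e) h)) a = (if Suc k = d then c else 0)"
    proof (cases "Suc k = d")
      case True
      then have "k = d - 1" by simp
      with e True show ?thesis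
        by (simp add: higher_pderiv_smult e_def)
    next
      case False
      then show ?thesis
        using poly_higher_pderiv_eq_0[OF h0, of k a] k ord by (simp add: higher_pderiv_smult)
    qed
  qed
qed

section \<open>Steering the image of the input matrix to zero\<close>

text \<open>The \<open>n + 1\<close> vectors \<open>X 0, \<dots>, X n\<close> with \<open>n\<close> entries each are linearly dependent; the
  relation is cut off after its last nonzero coefficient. Applied to \<open>X l = J\<^bsup>l\<^esup> x\<close>, it replaces the
  Cayley--Hamilton theorem.\<close>

lemma linear_relation_exists:
  fixes X :: "nat \<Rightarrow> nat \<Rightarrow> 'a::idom"
  shows "\<exists>d p. p d \<noteq> 0 \<and> (\<forall>r<n. (\<Sum>l\<le>d. p l * X l r) = 0)"
proof -
  \<comment> \<open>A zero row makes the \<open>n \<times> (n + 1)\<close> matrix of the vectors square and singular.\<close>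
  define M where "M = mat (Suc n) (Suc n) (\<lambda>(r, l). if r < n then X l r else 0)"
  have M: "M \<in> carrier_mat (Suc n) (Suc n)"
    by (simp add: M_def)
  have "M = mat\<^sub>r (Suc n) (Suc n)
      (\<lambda>i. if i = n then 0\<^sub>v (Suc n) else vec (Suc n) (\<lambda>l. X l i))"
    by (rule eq_matI) (auto simp: M_def)
  then have "det M = 0"
    using det_row_0[of n "Suc n" "\<lambda>i. vec (Suc n) (\<lambda>l. X l i)"] by simp
  then obtain v where v: "v \<in> carrier_vec (Suc n)" "v \<noteq> 0\<^sub>v (Suc n)" "M *\<^sub>v v = 0\<^sub>v (Suc n)"
    using det_0_iff_vec_prod_zero[OF M] by blast
  define p where "p l = (if l < Suc n then v $ l else 0)" for l
  have rel: "(\<Sum>l<Suc n. p l * X l r) = 0" if "r < n" for r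
  proof -
    have "0 = (M *\<^sub>v v) $ r"
      using v that by simp
    also have "\<dots> = (\<Sum>l<Suc n. p l * X l r)"
      using v(1) that by (simp add: M_def scalar_prod_def p_def lessThan_atLeast0 mult.commute
          del: sum.op_ivl_Suc)
    finally show ?thesis by simp
  qed
  define I where "I = {l. p l \<noteq> 0}"
  have "I \<noteq> {}"
    using v(1,2) by (auto simp: I_def p_def vec_eq_iff)
  have I: "I \<subseteq> {..<Suc n}"
    by (auto simp: I_def p_def)
  then have fin: "finite I"
    by (rule finite_subset) simp
  define d where "d = Max I"
  have "d \<in> I"
    using fin \<open>I \<noteq> {}\<close> by (simp add: d_def)
  have "(\<Sum>l\<le>d. p l * X l r) = 0" if "r < n" for r
  proof -
    have "(\<Sum>l\<le>d. p l * X l r) = (\<Sum>l<Suc n. p l * X l r)"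
    proof (rule sum.mono_neutral_left)
      show "{..d} \<subseteq> {..<Suc n}"
        using \<open>d \<in> I\<close> I by auto
      show "\<forall>l\<in>{..<Suc n} - {..d}. p l * X l r = 0"
        using Max_ge[OF fin] by (force simp: d_def I_def)
    qed simp
    with rel[OF that] show ?thesis by simp
  qed
  with \<open>d \<in> I\<close> show ?thesis
    by (auto simp: I_def)
qed

text \<open>The function \<open>w\<close> is the one given by the factorisation of \<open>p(\<partial>) - p(J)\<close>, where \<open>p\<close>
  annihilates \<open>x\<close>. The forcing term is a scalar multiple of \<open>x\<close> itself, so for \<open>x = C c\<close> it
  comes from the input \<open>\<psi> c\<close>.\<close>

lemma steering_to_zero:
  fixes J :: "real mat" and x :: "real vec" and a b :: real
  assumes J: "J \<in> carrier_mat n n" and x: "x \<in> carrier_vec n" and "a \<noteq> b"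
  shows "\<exists>\<psi> w. (\<forall>t. w t \<in> carrier_vec n) \<and> w a = - x \<and> w b = 0\<^sub>v n \<and>
    (\<forall>t. \<forall>r<n. ((\<lambda>s. w s $ r) has_real_derivative (J *\<^sub>v w t + poly \<psi> t \<cdot>\<^sub>v x) $ r) (at t))"
proof -
  define X where "X i r = (((\<lambda>v. J *\<^sub>v v) ^^ i) x) $ r" for i r
  have car: "((\<lambda>v. J *\<^sub>v v) ^^ i) x \<in> carrier_vec n" for i
    by (induction i) (use J x in auto)
  have X0: "X 0 r = x $ r" for r
    by (simp add: X_def)
  have XSuc: "(\<Sum>j<n. J $$ (r, j) * X i j) = X (Suc i) r" if "r < n" for i r
    using car[of i] J that by (simp add: X_def scalar_prod_def lessThan_atLeast0)
  obtain d p where pd: "p d \<noteq> 0" and rel: "\<And>r. r < n \<Longrightarrow> (\<Sum>l\<le>d. p l * X l r) = 0"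
    using linear_relation_exists[of n X] by blast
  obtain g where ga: "\<And>k. k < d \<Longrightarrow> poly ((pderiv ^^ k) g) a = (if Suc k = d then - 1 / p d else 0)"
    and gb: "\<And>k. k < d \<Longrightarrow> poly ((pderiv ^^ k) g) b = 0"
    using boundary_poly_exists[OF \<open>a \<noteq> b\<close>, of d "- 1 / p d"] by blast
  define G where "G k t = poly ((pderiv ^^ k) g) t" for k t
  have DG: "(G k has_real_derivative G (Suc k) t) (at t)" for k t
    unfolding G_def by (simp add: poly_DERIV)
  define w where "w t = vec n (\<lambda>r. \<Sum>l\<le>d. p l * (\<Sum>i<l. G (l - Suc i) t * X i r))" for t
  define \<psi> where "\<psi> = (\<Sum>l\<le>d. Polynomial.smult (p l) ((pderiv ^^ l) g))"
  have \<psi>: "poly \<psi> t = (\<Sum>l\<le>d. p l * G l t)" for t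
    by (simp add: \<psi>_def G_def poly_sum)
  have wa: "w a = - x"
  proof (rule eq_vecI)
    fix r assume "r < dim_vec (- x)"
    then have r: "r < n" using x by simp
    have inner: "(\<Sum>i<l. G (l - Suc i) a * X i r) = (if l = d then - x $ r / p d else 0)"
      if "l \<le> d" for l
    \<comment> \<open>For \<open>d = 0\<close> the relation says \<open>x = 0\<close>, and \<open>w\<close> vanishes identically.\<close>
    proof (cases "d = 0")
      case True
      then have "x $ r = 0"
        using rel[OF r] pd by (simp add: X0)
      with True that show ?thesis by simp
    next
      case False
      have "(\<Sum>i<l. G (l - Suc i) a * X i r) =
          (\<Sum>i<l. if i = 0 then if l = d then - x $ r / p d else 0 else 0)"
        using that by (intro sum.cong refl) (auto simp: G_def ga X0)
      with False show ?thesis by (auto simp: sum.delta)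
    qed
    have "w a $ r = (\<Sum>l\<le>d. p l * (if l = d then - x $ r / p d else 0))"
      using r by (simp add: w_def inner)
    also have "\<dots> = (\<Sum>l\<le>d. if l = d then - x $ r else 0)"
      using pd by (intro sum.cong) auto
    finally have "w a $ r = - x $ r"
      by simp
    then show "w a $ r = (- x) $ r"
      using r x by simp
  qed (use x in \<open>simp add: w_def\<close>)
  have wb: "w b = 0\<^sub>v n"
    by (rule eq_vecI) (auto simp: w_def G_def gb)
  have "((\<lambda>s. w s $ r) has_real_derivative (J *\<^sub>v w t + poly \<psi> t \<cdot>\<^sub>v x) $ r) (at t)"
    if r: "r < n" for t r
  proof -
    have "((\<lambda>s. w s $ r) has_real_derivative
        (\<Sum>l\<le>d. p l * (\<Sum>i<l. G (Suc (l - Suc i)) t * X i r))) (at t)"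
      using r unfolding w_def by (auto intro!: derivative_eq_intros DG simp: mult.commute)
    moreover have "(J *\<^sub>v w t) $ r =
        (\<Sum>l\<le>d. p l * (\<Sum>i<l. G (l - Suc i) t * X (Suc i) r))"
    proof -
      have "(J *\<^sub>v w t) $ r =
          (\<Sum>j<n. J $$ (r, j) * (\<Sum>l\<le>d. p l * (\<Sum>i<l. G (l - Suc i) t * X i j)))"
        using J r by (simp add: w_def scalar_prod_def lessThan_atLeast0)
      also have "\<dots> = (\<Sum>j<n. \<Sum>l\<le>d. \<Sum>i<l. p l * (G (l - Suc i) t * (J $$ (r, j) * X i j)))"
        by (simp add: sum_distrib_left mult_ac)
      also have "\<dots> = (\<Sum>l\<le>d. \<Sum>j<n. \<Sum>i<l. p l * (G (l - Suc i) t * (J $$ (r, j) * X i j)))"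
        by (rule sum.swap)
      also have "\<dots> = (\<Sum>l\<le>d. \<Sum>i<l. \<Sum>j<n. p l * (G (l - Suc i) t * (J $$ (r, j) * X i j)))"
        by (intro sum.cong refl sum.swap)
      also have "\<dots> = (\<Sum>l\<le>d. p l * (\<Sum>i<l. G (l - Suc i) t * (\<Sum>j<n. J $$ (r, j) * X i j)))"
        by (simp add: sum_distrib_left)
      finally show ?thesis
        by (simp add: XSuc[OF r])
    qed
    moreover have "(\<Sum>l\<le>d. p l * (\<Sum>i<l. G (Suc (l - Suc i)) t * X i r)) -
        (\<Sum>l\<le>d. p l * (\<Sum>i<l. G (l - Suc i) t * X (Suc i) r)) = poly \<psi> t * x $ r"
    proof -
      \<comment> \<open>This is \<open>\<partial>\<^bsup>l\<^esup> - J\<^bsup>l\<^esup> = (\<partial> - J) (\<Sum>i<l. \<partial>\<^bsup>l-1-i\<^esup> J\<^bsup>i\<^esup>)\<close> applied to \<open>g x\<close>.\<close>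
      have inner: "(\<Sum>i<l. G (Suc (l - Suc i)) t * X i r) -
          (\<Sum>i<l. G (l - Suc i) t * X (Suc i) r) = G l t * x $ r - G 0 t * X l r" for l
      proof -
        have "(\<Sum>i<l. G (Suc (l - Suc i)) t * X i r) - (\<Sum>i<l. G (l - Suc i) t * X (Suc i) r) =
            (\<Sum>i<l. G (l - i) t * X i r - G (l - Suc i) t * X (Suc i) r)"
          unfolding sum_subtractf[symmetric] by (intro sum.cong refl) (simp add: Suc_diff_Suc)
        also have "\<dots> = G l t * x $ r - G 0 t * X l r"
          using sum_lessThan_telescope'[of "\<lambda>i. G (l - i) t * X i r" l] by (simp add: X0)
        finally show ?thesis .
      qed
      have "(\<Sum>l\<le>d. p l * (\<Sum>i<l. G (Suc (l - Suc i)) t * X i r)) -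
          (\<Sum>l\<le>d. p l * (\<Sum>i<l. G (l - Suc i) t * X (Suc i) r)) =
          (\<Sum>l\<le>d. p l * ((\<Sum>i<l. G (Suc (l - Suc i)) t * X i r) -
            (\<Sum>i<l. G (l - Suc i) t * X (Suc i) r)))"
        by (simp add: sum_subtractf right_diff_distrib)
      also have "\<dots> = (\<Sum>l\<le>d. p l * (G l t * x $ r - G 0 t * X l r))"
        by (simp only: inner)
      also have "\<dots> = poly \<psi> t * x $ r - G 0 t * (\<Sum>l\<le>d. p l * X l r)"
        by (simp add: \<psi> sum_subtractf sum_distrib_left sum_distrib_right algebra_simps)
      finally show ?thesis
        using rel[OF r] by simp
    qed
    ultimately show ?thesis
      using r x J by (simp add: algebra_simps)
  qed
  moreover have "w t \<in> carrier_vec n" for t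
    by (simp add: w_def)
  ultimately show ?thesis
    using wa wb by blast
qed

section \<open>Removing the input jump on one segment\<close>

lemma hcat_mult_append:
  assumes A: "A \<in> carrier_mat n m" and B: "B \<in> carrier_mat n l"
    and u: "u \<in> carrier_vec m" and v: "v \<in> carrier_vec l"
  shows "hcat A B *\<^sub>v (u @\<^sub>v v) = A *\<^sub>v u + B *\<^sub>v v"
proof -
  have "hcat A B *\<^sub>v (u @\<^sub>v v) =
      (A *\<^sub>v u + B *\<^sub>v v) @\<^sub>v (0\<^sub>m 0 m *\<^sub>v u + 0\<^sub>m 0 l *\<^sub>v v)"
    unfolding hcat_def using A B u v
    by (subst four_block_mat_mult_vec[OF A B _ _ u v, of _ 0]) auto
  then show ?thesis
    using A B by (auto simp: vec_eq_iff)
qed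

lemma pw_smooth_mono:
  assumes f: "pw_smooth a b f" and "a \<le> c" "e \<le> b"
  shows "pw_smooth c e f"
proof -
  have sub: "{c<..<e} \<subseteq> {a<..<b}" "{c<..e} \<subseteq> {a<..b}" "{c..<e} \<subseteq> {a..<b}"
    using assms by auto
  show ?thesis
    using f sub unfolding pw_smooth_def by (meson subsetD Diff_iff)
qed

lemma pw_smooth_poly: "pw_smooth a b (poly p)"
proof -
  have cont: "(poly q \<longlongrightarrow> poly q t) (at t within S)" for q :: "real poly" and t S
    by (intro tendsto_intros)
  show ?thesis
    unfolding pw_smooth_def higher_deriv_poly
    using cont by (auto intro!: exI[of _ "{}"] poly_differentiable)
qed

lemma input_on_mono:
  assumes "input_on m a b u" and "a \<le> c" "e \<le> b"
  shows "input_on m c e u"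
  using assms unfolding input_on_def by (auto intro: pw_smooth_mono)

text \<open>Here \<open>C c\<close> is the jump of (I) at the start of the segment. The second block of the input steers
  its negative to zero by the end of the segment, and superposition does the rest.\<close>

lemma segment_correction:
  assumes J: "J \<in> carrier_mat n n" and B: "B \<in> carrier_mat n m" and C: "C \<in> carrier_mat n l"
    and c: "c \<in> carrier_vec l" and "a < b"
    and u: "input_on m a b u" and z: "ode_on J B a b u z"
  shows "\<exists>v y. input_on (m + l) a b v \<and> ode_on J (hcat B C) a b v y \<and>
    y a = z a - C *\<^sub>v c \<and> y b = z b"
proof -
  have x: "C *\<^sub>v c \<in> carrier_vec n"
    using C c by simp
  obtain \<psi> w where w: "\<And>t. w t \<in> carrier_vec n" and wa: "w a = - (C *\<^sub>v c)"
    and wb: "w b = 0\<^sub>v n"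
    and dw: "\<And>t r. r < n \<Longrightarrow> ((\<lambda>s. w s $ r) has_real_derivative
      (J *\<^sub>v w t + poly \<psi> t \<cdot>\<^sub>v (C *\<^sub>v c)) $ r) (at t)"
    using steering_to_zero[OF J x less_imp_neq[OF \<open>a < b\<close>]] by blast
  \<comment> \<open>The components enter piecewise smoothness as functions on the whole line, while \<open>u t\<close> has
    dimension \<open>m\<close> only for \<open>t \<in> {a..b}\<close>. Off this interval, appending to \<open>u t\<close> could shift the
    components, so the new input is defined entrywise.\<close>
  define v where "v t = vec (m + l)
    (\<lambda>i. if i < m then u t $ i else poly (Polynomial.smult (c $ (i - m)) \<psi>) t)" for t
  define y where "y t = z t + w t" for t
  have zt: "z t \<in> carrier_vec n" and ut: "u t \<in> carrier_vec m" if "t \<in> {a..b}" for t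
    using u z J that by (auto simp: input_on_def ode_on_def)
  have v_append: "v t = u t @\<^sub>v (poly \<psi> t \<cdot>\<^sub>v c)" if "t \<in> {a..b}" for t
    using ut[OF that] c by (auto simp: v_def)
  have "input_on (m + l) a b v"
  proof -
    have "pw_smooth a b (\<lambda>t. v t $ i)" if "i < m + l" for i
      using u that pw_smooth_poly[of a b "Polynomial.smult (c $ (i - m)) \<psi>"]
      by (cases "i < m") (simp_all add: input_on_def v_def del: poly_smult)
    then show ?thesis
      by (simp add: input_on_def v_def)
  qed
  moreover have "ode_on J (hcat B C) a b v y"
  proof -
    have rhs: "J *\<^sub>v y t + hcat B C *\<^sub>v v t =
        (J *\<^sub>v z t + B *\<^sub>v u t) + (J *\<^sub>v w t + poly \<psi> t \<cdot>\<^sub>v (C *\<^sub>v c))"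
      if "t \<in> {a..b}" for t
    proof -
      have "hcat B C *\<^sub>v v t = B *\<^sub>v u t + poly \<psi> t \<cdot>\<^sub>v (C *\<^sub>v c)"
        using hcat_mult_append[OF B C ut[OF that], of "poly \<psi> t \<cdot>\<^sub>v c"] C c
        by (simp add: v_append[OF that] mult_mat_vec)
      moreover have "J *\<^sub>v y t = J *\<^sub>v z t + J *\<^sub>v w t"
        using J zt[OF that] w by (simp add: y_def mult_add_distrib_mat_vec)
      ultimately show ?thesis
        using J B C by (auto simp: vec_eq_iff)
    qed
    from z obtain F where F: "finite F" and dz: "\<And>t r. t \<in> {a<..<b} - F \<Longrightarrow> r < n \<Longrightarrow>
        ((\<lambda>s. z s $ r) has_real_derivative (J *\<^sub>v z t + B *\<^sub>v u t) $ r) (at t)"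
      using J unfolding ode_on_def by auto
    have y_index: "(\<lambda>t. y t $ r) = (\<lambda>t. z t $ r + w t $ r)" if "r < n" for r
      using that carrier_vecD[OF w] by (simp add: y_def)
    have "((\<lambda>s. y s $ r) has_real_derivative (J *\<^sub>v y t + hcat B C *\<^sub>v v t) $ r) (at t)"
      if "t \<in> {a<..<b} - F" "r < n" for t r
    proof -
      have "t \<in> {a..b}"
        using that by auto
      moreover have "(\<lambda>t. y t $ r) = (\<lambda>t. z t $ r + w t $ r)"
        using y_index that by blast
      ultimately show ?thesis
        using DERIV_add[OF dz[OF that] dw[OF that(2)]] J B C c that(2) by (simp add: rhs)
    qed
    moreover have "continuous_on {a..b} (\<lambda>t. y t $ r)" if "r < n" for r
    proof -
      have "continuous_on {a..b} (\<lambda>t. w t $ r)"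
        using DERIV_isCont[OF dw[OF that]] by (intro continuous_at_imp_continuous_on) blast
      then show ?thesis
        using z J that unfolding y_index[OF that] ode_on_def by (auto intro!: continuous_on_add)
    qed
    ultimately show ?thesis
      using J F zt w unfolding ode_on_def by (auto simp: y_def)
  qed
  moreover have "y a = z a - C *\<^sub>v c"
    using zt[of a] x \<open>a < b\<close> by (auto simp: y_def wa)
  moreover have "y b = z b"
    using zt[of b] \<open>a < b\<close> by (simp add: y_def wb)
  ultimately show ?thesis
    by blast
qed

section \<open>Joining the segments\<close>

lemma present_less_seg_end:
  assumes "strict_mono_on {k. enat k \<le> K} tau" and "present K tau tf k"
  shows "tau k < seg_end K tau tf k" and "seg_end K tau tf k \<le> tf"
proof -
  have "tau k < tau (Suc k)" if "present K tau tf (Suc k)"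
    using assms that unfolding present_def by (intro strict_mono_onD[OF assms(1)]) auto
  then show "tau k < seg_end K tau tf k" "seg_end K tau tf k \<le> tf"
    using assms(2) by (auto simp: seg_end_def present_def)
qed

lemma present_le:
  assumes mono: "strict_mono_on {k. enat k \<le> K} tau" and k: "present K tau tf k" and "i \<le> k"
  shows "present K tau tf i" and "tau i \<le> tau k"
proof -
  have K: "enat k \<le> K" "enat i \<le> K"
    using k \<open>i \<le> k\<close> order_trans[of "enat i" "enat k" K] by (auto simp: present_def)
  show "tau i \<le> tau k"
    using strict_mono_onD[OF mono, of i k] K \<open>i \<le> k\<close> by (cases "i = k") auto
  then show "present K tau tf i"
    using k K by (simp add: present_def)
qed

theorem theorem3p3:
  fixes D :: swdae and q :: "real \<Rightarrow> nat" and t0 :: real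
    and K :: enat and tau :: "nat \<Rightarrow> real"
  assumes E: "\<And>j. j \<in> {1..n_modes D} \<Longrightarrow> Emat D j \<in> carrier_mat (dim_x D) (dim_x D)"
    and A: "\<And>j. j \<in> {1..n_modes D} \<Longrightarrow> Amat D j \<in> carrier_mat (dim_x D) (dim_x D)"
    and B: "\<And>j. j \<in> {1..n_modes D} \<Longrightarrow> Bmat D j \<in> carrier_mat (dim_x D) (dim_u D)"
    and regular: "\<And>j. j \<in> {1..n_modes D} \<Longrightarrow> regular_pair (Emat D j) (Amat D j)"
    and stable: "\<And>j s. j \<in> {1..n_modes D} \<Longrightarrow> finite_eigenvalue (Emat D j) (Amat D j) s \<Longrightarrow> Re s < 0"
    and qwf: "\<And>j. j \<in> {1..n_modes D} \<Longrightarrow>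
      quasi_weierstrass (dim_x D) (Emat D j) (Amat D j) (Smat D j) (Tmat D j)
        (dimJ D j) (Jmat D j) (Nmat D j)"
    and signal: "switching_signal (n_modes D) q"
    and times: "switching_times q t0 K tau"
  shows "reachable_I D q K tau \<subseteq> reachable_II D q K tau"
proof
  fix x assume "x \<in> reachable_I D q K tau"
  then obtain tf u z k where tf: "tau 0 < tf" and u: "input_on (dim_u D) (tau 0) tf u"
    and sol: "solution_I D q K tau tf u z" and last: "last_seg K tau tf k" and x: "x = z k tf"
    by (auto simp: reachable_I_def)
  have mono: "strict_mono_on {k. enat k \<le> K} tau"
    using times by (simp add: switching_times_def)
  have mode: "q t \<in> {1..n_modes D}" for t
    using signal by (simp add: switching_signal_def)
  have J: "Jmat D (q t) \<in> carrier_mat (dimJ D (q t)) (dimJ D (q t))" for t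
    using qwf[OF mode] by (simp add: quasi_weierstrass_def)
  have Btilde: "Btilde D (q t) \<in> carrier_mat (dimJ D (q t)) (dim_u D)" for t
    using carrier_matD[OF B[OF mode]] by (intro carrier_matI) (simp_all add: Btilde_def Iproj_def)
  have Bcal: "Bcal D (q t) i \<in> carrier_mat (dimJ D (q t)) (dim_u D * nu D i)" for t i
    by (intro carrier_matI) (simp_all add: Bcal_def TinvT_def Iproj_def hcat_blocks_def)
  have P: "dim_row (Ptilde D j i) = dimJ D j" for j i
    by (simp add: Ptilde_def TinvT_def Iproj_def)
  have ode: "ode_on (Jmat D (q (tau k))) (Btilde D (q (tau k))) (tau k) (seg_end K tau tf k) u (z k)"
    and jump: "1 \<le> k \<Longrightarrow> z k (tau k) =
          Ptilde D (q (tau k)) (q (tau (k - 1))) *\<^sub>v z (k - 1) (tau k) +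
          Bcal D (q (tau k)) (q (tau (k - 1))) *\<^sub>v
            U_left (dim_u D) (nu D (q (tau (k - 1)))) u (tau k)"
    if "present K tau tf k" for k
    using sol that unfolding solution_I_def by blast+
  have z0: "z 0 (tau 0) = 0\<^sub>v (dimJ D (q (tau 0)))"
    using sol unfolding solution_I_def by blast

  \<comment> \<open>The conditions on segment \<open>k\<close> refer to the given trajectory \<open>z\<close> of (I) instead of the
    neighbouring segments of the new one. So the segments can be corrected independently, and
    agreement with \<open>z\<close> at the segment ends yields the jump conditions of (II).\<close>
  define matched where "matched k v y \<longleftrightarrow>
      input_on (dim_ubar D q tau k) (tau k) (seg_end K tau tf k) v \<and>
      ode_on (Jmat D (q (tau k))) (Bbar D q tau k) (tau k) (seg_end K tau tf k) v y \<and>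
      y (tau k) = (if k = 0 then 0\<^sub>v (dimJ D (q (tau 0)))
        else Ptilde D (q (tau k)) (q (tau (k - 1))) *\<^sub>v z (k - 1) (tau k)) \<and>
      y (seg_end K tau tf k) = z k (seg_end K tau tf k)" for k v y
  have "\<exists>v y. present K tau tf k \<longrightarrow> matched k v y" for k
  proof (cases "present K tau tf k")
    case True
    note ends = present_less_seg_end[OF mono True]
    have u_k: "input_on (dim_u D) (tau k) (seg_end K tau tf k) u"
      using input_on_mono[OF u present_le(2)[OF mono True] ends(2)] by simp
    show ?thesis
    proof (cases "k = 0")
      case True
      then show ?thesis
        using u_k ode[OF \<open>present K tau tf k\<close>] z0
        by (intro exI[of _ u] exI[of _ "z k"]) (simp add: matched_def dim_ubar_def Bbar_def)
    next
      case False
      let ?i = "q (tau (k - 1))"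
      let ?c = "U_left (dim_u D) (nu D ?i) u (tau k)"
      have c: "?c \<in> carrier_vec (dim_u D * nu D ?i)"
        by (simp add: U_left_def)
      have "z k (tau k) - Bcal D (q (tau k)) ?i *\<^sub>v ?c =
          Ptilde D (q (tau k)) ?i *\<^sub>v z (k - 1) (tau k)"
        using jump[OF True] False Bcal[of "tau k" ?i] by (auto simp: vec_eq_iff P)
      moreover obtain v y
        where "input_on (dim_u D + dim_u D * nu D ?i) (tau k) (seg_end K tau tf k) v"
          and "ode_on (Jmat D (q (tau k))) (hcat (Btilde D (q (tau k))) (Bcal D (q (tau k)) ?i))
            (tau k) (seg_end K tau tf k) v y"
          and "y (tau k) = z k (tau k) - Bcal D (q (tau k)) ?i *\<^sub>v ?c"
          and "y (seg_end K tau tf k) = z k (seg_end K tau tf k)"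
        using segment_correction[OF J Btilde Bcal c ends(1) u_k ode[OF True]] by blast
      ultimately have "matched k v y"
        using False by (simp add: matched_def dim_ubar_def Bbar_def)
      then show ?thesis by blast
    qed
  qed simp
  then obtain v y where "\<And>k. present K tau tf k \<Longrightarrow> matched k (v k) (y k)"
    by metis
  note vy = this[unfolded matched_def]
  have y_jump: "y k (tau k) = Ptilde D (q (tau k)) (q (tau (k - 1))) *\<^sub>v y (k - 1) (tau k)"
    if "1 \<le> k" "present K tau tf k" for k
  proof -
    have "present K tau tf (k - 1)"
      using present_le(1)[OF mono that(2)] by simp
    moreover have "seg_end K tau tf (k - 1) = tau k"
      using that by (simp add: seg_end_def)
    ultimately have "y (k - 1) (tau k) = z (k - 1) (tau k)"
      using vy[of "k - 1"] by simp
    then show ?thesis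
      using vy[OF that(2)] that(1) by simp
  qed
  have pres: "present K tau tf k" and "seg_end K tau tf k = tf"
    using last by (auto simp: last_seg_def seg_end_def)
  then have "x = y k tf"
    using vy[of k] x by simp
  moreover have "y 0 (tau 0) = 0\<^sub>v (dimJ D (q (tau 0)))"
    using vy[of 0] present_le(1)[OF mono pres] by simp
  then have "solution_II D q K tau tf v y"
    unfolding solution_II_def using vy y_jump by blast
  moreover have "input_II D q K tau tf v"
    unfolding input_II_def using vy by blast
  ultimately show "x \<in> reachable_II D q K tau"
    unfolding reachable_II_def using tf last by blast
qed

end
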